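(* Suppose that $f(x)=\tfrac12 x'Qx+q'x$ is convex quadratic. If $0<\gamma<1/L_f$, then $F^{\mathrm{DR}}_\gamma$ is convex, its gradient is Lipschitz continuous with constant $$L_{F^{\mathrm{DR}}_\gamma}=\frac{1-\gamma\mu_f}{1+\gamma\mu_f}\,\gamma^{-1},$$ and it has convexity modulus $$\mu_{F^{\mathrm{DR}}_\gamma}=\min\left\{\frac{(1-\gamma\mu_f)\mu_f}{(1+\gamma\mu_f)^2},\ \frac{(1-\gamma L_f)L_f}{(1+\gamma L_f)^2}\right\},$$ i.e. $F^{\mathrm{DR}}_\gamma-\tfrac12\mu_{F^{\mathrm{DR}}_\gamma}\|\cdot\|^2$ is convex.
   Context: $Q\in\mathbb{R}^{n\times n}$ is symmetric positive semidefinite, $q\in\mathbb{R}^n$, $\mu_f=\lambda_{\min}(Q)$, $L_f=\lambda_{\max}(Q)$. Let $g:\mathbb{R}^n\to\mathbb{R}\cup\{+\infty\}$ be proper, closed and convex. Put $F=f+g$ and assume that the set of minimizers of $F$ is nonempty. For $\gamma>0$ and a proper closed convex function $h$, $h^\gamma(x)=\inf_z\{h(z)+\tfrac{1}{2\gamma}\|z-x\|^2\}$ is the Moreau envelope (which is differentiable). The Douglas-Rachford envelope is $$F^{\mathrm{DR}}_\gamma(x)=f^\gamma(x)-\gamma\|\nabla f^\gamma(x)\|^2+g^\gamma\bigl(x-2\gamma\nabla f^\gamma(x)\bigr),\quad x\in\mathbb{R}^n.$$ Convention: $1/L_f=+\infty$ if $L_f=0$. *)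

theory Defs
  imports "HOL-Analysis.Analysis"
begin

section \<open>Extremal eigenvalues of a real matrix\<close>

definition eigenvalues :: "real ^ 'n ^ 'n \<Rightarrow> real set" where
  "eigenvalues A = {l. \<exists>v. v \<noteq> 0 \<and> A *v v = l *\<^sub>R v}"

text \<open>\<open>Min\<close> and \<open>Max\<close> are meaningful for symmetric matrices, whose set of real
  eigenvalues is finite and nonempty.\<close>

definition eig_min :: "real ^ 'n ^ 'n \<Rightarrow> real" where
  "eig_min A = Min (eigenvalues A)"

definition eig_max :: "real ^ 'n ^ 'n \<Rightarrow> real" where
  "eig_max A = Max (eigenvalues A)"

definition psd :: "real ^ 'n ^ 'n \<Rightarrow> bool" where
  "psd A \<longleftrightarrow> transpose A = A \<and> (\<forall>x. 0 \<le> x \<bullet> (A *v x))"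

definition quadratic :: "real ^ 'n ^ 'n \<Rightarrow> real ^ 'n \<Rightarrow> real ^ 'n \<Rightarrow> real" where
  "quadratic Q q x = 1 / 2 * (x \<bullet> (Q *v x)) + q \<bullet> x"

section \<open>Extended-real-valued convex functions\<close>

text \<open>The epigraph lives in the product of the space with the (finite) reals. The constant
  \<open>epigraph\<close> of HOL-Analysis only covers real-valued functions.\<close>

definition epi :: "('a \<Rightarrow> ereal) \<Rightarrow> ('a \<times> real) set" where
  "epi h = {(x, t). h x \<le> ereal t}"

definition proper_closed_convex :: "('a::euclidean_space \<Rightarrow> ereal) \<Rightarrow> bool" where
  "proper_closed_convex h \<longleftrightarrow>
     (\<forall>x. h x \<noteq> -\<infinity>) \<and> (\<exists>x. h x \<noteq> \<infinity>) \<and> closed (epi h) \<and> convex (epi h)"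

definition minimizers :: "('a \<Rightarrow> ereal) \<Rightarrow> 'a set" where
  "minimizers h = {x. \<forall>y. h x \<le> h y}"

section \<open>Moreau and Douglas-Rachford envelopes\<close>

text \<open>The infimum is taken in the extended reals. It is finite whenever \<open>h\<close> is proper,
  closed and convex and \<open>\<gamma> > 0\<close>, so that \<open>real_of_ereal\<close> loses no information then.\<close>

definition moreau_env :: "real \<Rightarrow> ('a::euclidean_space \<Rightarrow> ereal) \<Rightarrow> 'a \<Rightarrow> real" where
  "moreau_env \<gamma> h x = real_of_ereal (INF z. h z + ereal (1 / (2 * \<gamma>) * (norm (z - x))\<^sup>2))"

text \<open>The gradient is uniquely determined at points of differentiability and arbitrary
  elsewhere.\<close>

definition gradient :: "('a::euclidean_space \<Rightarrow> real) \<Rightarrow> 'a \<Rightarrow> 'a" where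
  "gradient \<phi> x = (THE D. GDERIV \<phi> x :> D)"

definition dr_env ::
  "real \<Rightarrow> ('a::euclidean_space \<Rightarrow> ereal) \<Rightarrow> ('a \<Rightarrow> ereal) \<Rightarrow> 'a \<Rightarrow> real" where
  "dr_env \<gamma> f g x =
     moreau_env \<gamma> f x - \<gamma> * (norm (gradient (moreau_env \<gamma> f) x))\<^sup>2
     + moreau_env \<gamma> g (x - (2 * \<gamma>) *\<^sub>R gradient (moreau_env \<gamma> f) x)"

end

theory Submission
  imports Defs
begin

text \<open>Let \<open>p = prox\<^sub>f x\<close>, so that \<open>x = p + \<gamma> \<nabla>f(p)\<close> and \<open>\<nabla>f\<^sup>\<gamma>(x) = \<nabla>f(p)\<close>. In terms of \<open>p\<close> the
  Douglas-Rachford envelope becomes a forward-backward envelope: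
  \<open>F(x) = f(p) - (\<gamma>/2) |\<nabla>f(p)|\<^sup>2 + g\<^sup>\<gamma>(p - \<gamma> \<nabla>f(p))\<close> (lemma \<open>F_eq\<close>). For a quadratic \<open>f\<close> the map
  \<open>x \<mapsto> p\<close> is affine with linear part \<open>M = (I + \<gamma> Q)\<^sup>-\<^sup>1\<close>, and the argument
  \<open>p - \<gamma> \<nabla>f(p) = 2p - x\<close> of \<open>g\<^sup>\<gamma>\<close> is affine with linear part \<open>R = 2M - I = (I - \<gamma> Q) M\<close>. Thus \<open>F\<close> is
  a quadratic with Hessian \<open>H = Q (I - \<gamma> Q) (I + \<gamma> Q)\<^sup>-\<^sup>2\<close> plus a convex smooth function composed
  with an affine map, which gives \<open>\<nabla>F(x) = \<gamma>\<^sup>-\<^sup>1 R (p - prox\<^sub>g(2p - x))\<close>.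

  Convexity: the second summand is convex, so the modulus of \<open>F\<close> is at least the smallest eigenvalue
  of \<open>H\<close>. The eigenvalues of \<open>H\<close> are \<open>\<lambda> (1 - \<gamma>\<lambda>) / (1 + \<gamma>\<lambda>)\<^sup>2\<close>, and such an expression is smallest
  at an extremal \<open>\<lambda>\<close>, because its superlevel sets are cut out by concave quadratic polynomials.

  Lipschitz constant: write \<open>u\<close> for a difference of two arguments, and \<open>\<pi>\<close> for the corresponding
  difference of values of \<open>prox\<^sub>g\<close>. Since \<open>prox\<^sub>g\<close> is firmly nonexpansive, \<open>|Ru - 2\<pi>| \<le> |Ru| \<le> |u|\<close>;
  as \<open>Mu - \<pi>\<close> is the mean of \<open>u\<close> and \<open>Ru - 2\<pi>\<close>, it is no longer than \<open>u\<close>. The gradient changes by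
  \<open>\<gamma>\<^sup>-\<^sup>1 R (Mu - \<pi>)\<close>, so the constant is \<open>|R| / \<gamma>\<close>, and \<open>|R| \<le> (1 - \<gamma>\<mu>) / (1 + \<gamma>\<mu>)\<close>.

  The two bounds on functions of \<open>Q\<close> are instances of \<open>concave_polynomial_form_nonneg\<close>, which
  replaces the spectral theorem; the inequalities for \<open>g\<^sup>\<gamma>\<close> are \<open>moreau_env_lower\<close> and
  \<open>moreau_env_upper\<close>.\<close>

section \<open>Self-adjoint operators\<close>

definition self_adjoint :: "('a::real_inner \<Rightarrow> 'a) \<Rightarrow> bool" where
  "self_adjoint T \<longleftrightarrow> linear T \<and> (\<forall>x y. T x \<bullet> y = x \<bullet> T y)"

lemma self_adjoint_linear: "self_adjoint T \<Longrightarrow> linear T"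
  and self_adjoint_swap: "self_adjoint T \<Longrightarrow> T x \<bullet> y = x \<bullet> T y"
  by (auto simp: self_adjoint_def)

lemma self_adjoint_matrix:
  assumes "transpose Q = (Q :: real^'n^'n)"
  shows "self_adjoint ((*v) Q)"
  unfolding self_adjoint_def
proof (intro conjI allI)
  show "(Q *v x) \<bullet> y = x \<bullet> (Q *v y)" for x y
    by (metis assms dot_lmul_matrix transpose_matrix_vector)
qed simp

lemma self_adjoint_shift:
  assumes "self_adjoint T"
  shows "self_adjoint (\<lambda>x. T x - c *\<^sub>R x)" "self_adjoint (\<lambda>x. c *\<^sub>R x - T x)"
proof -
  have "linear ((*\<^sub>R) c)" by (rule linear_scaleR)
  with self_adjoint_linear[OF assms]
  have "linear (\<lambda>x. T x - c *\<^sub>R x)" "linear (\<lambda>x. c *\<^sub>R x - T x)"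
    by (simp_all add: linear_compose_sub)
  then show "self_adjoint (\<lambda>x. T x - c *\<^sub>R x)" "self_adjoint (\<lambda>x. c *\<^sub>R x - T x)"
    using self_adjoint_swap[OF assms]
    by (simp_all add: self_adjoint_def inner_diff_left inner_diff_right)
qed

text \<open>A nonnegative quadratic form that vanishes at \<open>v\<close> is minimal there, so its derivative at \<open>v\<close>
  vanishes too. Moving from \<open>v\<close> a small step against \<open>S v\<close> would otherwise make the form negative.\<close>

lemma nonneg_form_kernel:
  fixes S :: "'a::real_inner \<Rightarrow> 'a"
  assumes S: "self_adjoint S" and nonneg: "\<And>x. 0 \<le> x \<bullet> S x" and zero: "v \<bullet> S v = 0"
  shows "S v = 0"
proof (rule ccontr)
  assume "S v \<noteq> 0"
  define a b where "a = S v \<bullet> S v" and "b = S v \<bullet> S (S v)"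
  have a: "a > 0" and b: "b \<ge> 0"
    using \<open>S v \<noteq> 0\<close> nonneg by (auto simp: a_def b_def)
  \<comment> \<open>A step for which the value \<open>2ta + t\<^sup>2b\<close> of the form is negative, whatever \<open>b \<ge> 0\<close>.\<close>
  define t where "t = - a / (b + 1)"
  have "0 \<le> (v + t *\<^sub>R S v) \<bullet> S (v + t *\<^sub>R S v)" by (rule nonneg)
  also have "\<dots> = 2 * t * a + t\<^sup>2 * b"
    using zero self_adjoint_swap[OF S, of v "S v"] self_adjoint_linear[OF S]
    by (simp add: a_def b_def linear_add linear_scale inner_add_left inner_add_right
        power2_eq_square algebra_simps)
  also have "\<dots> = - (a\<^sup>2 * (b + 2) / (b + 1)\<^sup>2)"
    using b by (simp add: t_def divide_simps power2_eq_square) algebra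
  also have "\<dots> < 0"
    using a b by simp
  finally show False by simp
qed

section \<open>Extremal eigenvalues\<close>

text \<open>The minimum of the form on the unit sphere is attained by compactness; at a minimizer the
  nonnegative form of \<open>T - m I\<close> vanishes, which makes the minimizer an eigenvector.\<close>

lemma rayleigh_minimum:
  fixes T :: "'a::euclidean_space \<Rightarrow> 'a"
  assumes T: "self_adjoint T"
  obtains m v where "v \<noteq> 0" "T v = m *\<^sub>R v" "\<And>x. m * (norm x)\<^sup>2 \<le> x \<bullet> T x"
proof -
  have lin: "linear T" by (rule self_adjoint_linear[OF T])
  have "\<exists>v\<in>sphere 0 1. \<forall>y\<in>sphere 0 1. v \<bullet> T v \<le> y \<bullet> T y"
    by (intro continuous_attains_inf continuous_intros linear_continuous_on
        linear_conv_bounded_linear[THEN iffD1] lin compact_sphere) simp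
  then obtain v where v: "norm v = 1" and
    min: "\<And>y. norm y = 1 \<Longrightarrow> v \<bullet> T v \<le> y \<bullet> T y" by auto
  define m where "m = v \<bullet> T v"
  have m: "m * (norm x)\<^sup>2 \<le> x \<bullet> T x" for x
  proof (cases "x = 0")
    case False
    have "m \<le> (x /\<^sub>R norm x) \<bullet> T (x /\<^sub>R norm x)"
      unfolding m_def using False by (intro min) simp
    also have "\<dots> = (x \<bullet> T x) / (norm x)\<^sup>2"
      by (simp add: linear_scale[OF lin] power2_eq_square divide_simps)
    finally show ?thesis using False by (simp add: field_simps)
  qed simp
  have "T v - m *\<^sub>R v = 0"
  proof (rule nonneg_form_kernel[OF self_adjoint_shift(1)[OF T]])
    show "0 \<le> x \<bullet> (T x - m *\<^sub>R x)" for x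
      using m[of x] by (simp add: inner_diff_right power2_norm_eq_inner)
    show "v \<bullet> (T v - m *\<^sub>R v) = 0"
      using v by (simp add: inner_diff_right m_def flip: power2_norm_eq_inner)
  qed
  then show thesis using that[of v m] v m by force
qed

text \<open>Eigenvectors for distinct eigenvalues are orthogonal, hence independent. Finiteness is what gives
  \<open>Min\<close> and \<open>Max\<close> of the set of eigenvalues their meaning.\<close>

lemma finite_eigenvalues:
  fixes Q :: "real^'n^'n"
  assumes "transpose Q = Q"
  shows "finite (eigenvalues Q)"
proof -
  define w where "w l = (SOME v. v \<noteq> 0 \<and> Q *v v = l *\<^sub>R v)" for l
  have w: "w l \<noteq> 0 \<and> Q *v w l = l *\<^sub>R w l" if "l \<in> eigenvalues Q" for l
  proof -
    have "\<exists>v. v \<noteq> 0 \<and> Q *v v = l *\<^sub>R v" using that by (simp add: eigenvalues_def)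
    then show ?thesis unfolding w_def by (rule someI_ex)
  qed
  have orth: "w k \<bullet> w l = 0" if "k \<in> eigenvalues Q" "l \<in> eigenvalues Q" "k \<noteq> l" for k l
    using self_adjoint_swap[OF self_adjoint_matrix[OF assms], of "w k" "w l"]
      w[OF that(1)] w[OF that(2)] that(3) by auto
  have "independent (w ` eigenvalues Q)"
    using w orth by (intro pairwise_orthogonal_independent)
      (auto simp: pairwise_def orthogonal_def)
  then have "finite (w ` eigenvalues Q)" by (rule independent_imp_finite)
  moreover have "inj_on w (eigenvalues Q)"
    using w orth by (metis inj_onI inner_eq_zero_iff)
  ultimately show ?thesis by (rule finite_imageD)
qed

lemma eig_min_le_form:
  fixes Q :: "real^'n^'n"
  assumes "transpose Q = Q"
  shows "eig_min Q \<in> eigenvalues Q" "eig_min Q * (norm x)\<^sup>2 \<le> x \<bullet> (Q *v x)"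
proof -
  obtain m v where v: "v \<noteq> 0" "Q *v v = m *\<^sub>R v"
    and m: "\<And>x. m * (norm x)\<^sup>2 \<le> x \<bullet> (Q *v x)"
    using rayleigh_minimum[OF self_adjoint_matrix[OF assms]] by metis
  have mem: "m \<in> eigenvalues Q" using v by (auto simp: eigenvalues_def)
  show "eig_min Q \<in> eigenvalues Q"
    unfolding eig_min_def using mem by (intro Min_in finite_eigenvalues[OF assms]) auto
  have "eig_min Q \<le> m"
    unfolding eig_min_def using mem by (intro Min_le finite_eigenvalues[OF assms])
  then have "eig_min Q * (norm x)\<^sup>2 \<le> m * (norm x)\<^sup>2" by (intro mult_right_mono) auto
  then show "eig_min Q * (norm x)\<^sup>2 \<le> x \<bullet> (Q *v x)" using m[of x] by linarith
qed

lemma form_le_eig_max: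
  fixes Q :: "real^'n^'n"
  assumes "transpose Q = Q"
  shows "x \<bullet> (Q *v x) \<le> eig_max Q * (norm x)\<^sup>2"
proof -
  \<comment> \<open>The maximum of the form of \<open>Q\<close> is the minimum of that of \<open>- Q\<close>, written as a shift by 0.\<close>
  have "self_adjoint (\<lambda>x. 0 *\<^sub>R x - Q *v x)"
    by (rule self_adjoint_shift(2)[OF self_adjoint_matrix[OF assms]])
  then obtain m v where v: "v \<noteq> 0" "0 *\<^sub>R v - Q *v v = m *\<^sub>R v"
    and m: "\<And>x. m * (norm x)\<^sup>2 \<le> x \<bullet> (0 *\<^sub>R x - Q *v x)"
    by (rule rayleigh_minimum) blast
  have "Q *v v = (- m) *\<^sub>R v" using v(2) by (metis diff_0 minus_minus scaleR_minus_left scaleR_zero_left)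
  then have "- m \<in> eigenvalues Q" using v(1) unfolding eigenvalues_def by blast
  then have "- m \<le> eig_max Q"
    unfolding eig_max_def by (intro Max_ge finite_eigenvalues[OF assms])
  then have "- m * (norm x)\<^sup>2 \<le> eig_max Q * (norm x)\<^sup>2" by (intro mult_right_mono) auto
  then show ?thesis using m[of x] by simp
qed

text \<open>A concave quadratic polynomial that is nonnegative at \<open>\<mu>\<close> and at \<open>L\<close> is nonnegative between
  them, so the operator \<open>p0 I + p1 T + p2 T\<^sup>2\<close> should be positive semidefinite when the spectrum
  of \<open>T\<close> lies in \<open>[\<mu>, L]\<close>. Indeed, for \<open>\<mu> < L\<close>, with \<open>S = T - \<mu> I\<close> and \<open>W = L I - T\<close>,
  \<open>(L - \<mu>)\<close> times the operator is a nonnegative combination of \<open>S\<close>, \<open>W\<close> and \<open>SW\<close>, and \<open>SW\<close> is positive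
  semidefinite because \<open>(L - \<mu>) SW = SW (S + W) = SWS + WSW\<close>.\<close>

lemma concave_polynomial_form_nonneg:
  fixes T :: "'a::euclidean_space \<Rightarrow> 'a"
  assumes T: "self_adjoint T"
    and lower: "\<And>x. \<mu> * (norm x)\<^sup>2 \<le> x \<bullet> T x" and upper: "\<And>x. x \<bullet> T x \<le> L * (norm x)\<^sup>2"
    and concave: "p2 \<le> 0"
    and at_lower: "0 \<le> p0 + p1 * \<mu> + p2 * \<mu>\<^sup>2" and at_upper: "0 \<le> p0 + p1 * L + p2 * L\<^sup>2"
  shows "0 \<le> p0 * (norm v)\<^sup>2 + p1 * (v \<bullet> T v) + p2 * (norm (T v))\<^sup>2"
proof -
  define S W where "S x = T x - \<mu> *\<^sub>R x" and "W x = L *\<^sub>R x - T x" for x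
  define c where "c = L - \<mu>"
  have saS: "self_adjoint S" and saW: "self_adjoint W"
    unfolding S_def[abs_def] W_def[abs_def] by (rule self_adjoint_shift[OF T])+
  have S: "0 \<le> x \<bullet> S x" and W: "0 \<le> x \<bullet> W x" for x
    using lower[of x] upper[of x]
    by (auto simp: S_def W_def inner_diff_right power2_norm_eq_inner)
  have sum: "S x + W x = c *\<^sub>R x" for x
    by (simp add: S_def W_def c_def algebra_simps)
  obtain b :: 'a where "norm b = 1"
    using norm_Basis[OF SOME_Basis] by blast
  then have "c \<ge> 0"
    using lower[of b] upper[of b] by (simp add: c_def)
  then consider "c = 0" | "c > 0" by linarith
  then show ?thesis
  proof cases
    case 1
    \<comment> \<open>Here \<open>\<mu> = L\<close> forces \<open>T = \<mu> I\<close>.\<close>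
    have "v \<bullet> S v + v \<bullet> W v = 0"
      using sum[of v] 1 by (simp flip: inner_add_right)
    then have "v \<bullet> S v = 0"
      using S[of v] W[of v] by linarith
    then have "S v = 0" by (rule nonneg_form_kernel[OF saS S])
    then have "T v = \<mu> *\<^sub>R v" by (simp add: S_def)
    then have "p0 * (norm v)\<^sup>2 + p1 * (v \<bullet> T v) + p2 * (norm (T v))\<^sup>2
        = (p0 + p1 * \<mu> + p2 * \<mu>\<^sup>2) * (norm v)\<^sup>2"
      by (simp add: power_mult_distrib algebra_simps flip: power2_norm_eq_inner)
    then show ?thesis using at_lower by simp
  next
    case 2
    have comm: "W (S v) = S (W v)"
      using self_adjoint_linear[OF T] by (simp add: S_def W_def linear_diff linear_scale algebra_simps)
    have "c * (S v \<bullet> W v) = S v \<bullet> W (c *\<^sub>R v)"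
      using self_adjoint_linear[OF saW] by (simp add: linear_scale)
    also have "\<dots> = S v \<bullet> W (S v) + S v \<bullet> W (W v)"
      using self_adjoint_linear[OF saW] by (simp add: linear_add inner_add_right flip: sum)
    also have "S v \<bullet> W (W v) = W v \<bullet> S (W v)"
      by (metis comm inner_commute self_adjoint_swap[OF saW])
    finally have "0 \<le> c * (S v \<bullet> W v)"
      using W[of "S v"] S[of "W v"] by simp
    then have prod: "0 \<le> S v \<bullet> W v"
      using 2 by (simp add: zero_le_mult_iff)
    have "c * (p0 * (norm v)\<^sup>2 + p1 * (v \<bullet> T v) + p2 * (norm (T v))\<^sup>2)
        = (p0 + p1 * \<mu> + p2 * \<mu>\<^sup>2) * (v \<bullet> W v) + (p0 + p1 * L + p2 * L\<^sup>2) * (v \<bullet> S v)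
          + (- p2) * c * (S v \<bullet> W v)"
      unfolding S_def W_def c_def power2_norm_eq_inner
      by (simp add: inner_diff_left inner_diff_right inner_commute[of "T v" v]
          algebra_simps power2_eq_square)
    also have "\<dots> \<ge> 0"
      using mult_nonneg_nonneg[OF at_lower W[of v]] mult_nonneg_nonneg[OF at_upper S[of v]]
        mult_nonneg_nonneg[OF mult_nonneg_nonneg[of "- p2" c] prod] concave 2
      by linarith
    finally show ?thesis using 2 by (simp add: zero_le_mult_iff)
  qed
qed

section \<open>Proximal maps and Moreau envelopes\<close>

text \<open>The variational inequality states that \<open>(x - P x) / \<gamma>\<close> is a subgradient of \<open>h\<close> at \<open>P x\<close>. For convex \<open>h\<close>
  this is equivalent to \<open>P x\<close> minimizing \<open>h(z) + |z - x|\<^sup>2 / 2\<gamma>\<close> over \<open>z\<close>, and it is the form in which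
  minimality is used below.\<close>

definition proximal_map ::
  "real \<Rightarrow> ('a::real_inner \<Rightarrow> ereal) \<Rightarrow> ('a \<Rightarrow> 'a) \<Rightarrow> bool" where
  "proximal_map \<gamma> h P \<longleftrightarrow> (\<forall>x. \<bar>h (P x)\<bar> \<noteq> \<infinity> \<and>
     (\<forall>z. h (P x) + ereal ((x - P x) \<bullet> (z - P x) / \<gamma>) \<le> h z))"

text \<open>Separating the epigraph from a point below it yields an affine minorant of \<open>h\<close>. Hence
  \<open>\<Phi>(z, t) = t + |z - x|\<^sup>2 / 2\<gamma>\<close> has bounded sublevel sets on the closed epigraph and attains its
  minimum there. Comparing the minimizer with points of the segment from it to another point of the
  epigraph, close to the minimizer, gives the variational inequality.\<close>

lemma proximal_map_exists:
  fixes h :: "'a::euclidean_space \<Rightarrow> ereal"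
  assumes h: "proper_closed_convex h" and \<gamma>: "\<gamma> > 0"
  shows "\<exists>P. proximal_map \<gamma> h P"
proof -
  have proper: "\<And>x. h x \<noteq> -\<infinity>" and "\<exists>x. h x \<noteq> \<infinity>"
    and cl: "closed (epi h)" and cv: "convex (epi h)"
    using h by (auto simp: proper_closed_convex_def)
  then obtain z0 where "h z0 \<noteq> \<infinity>" by blast
  then obtain t0 where t0: "h z0 = ereal t0" using proper[of z0] by (cases "h z0") auto
  have "(z0, t0 - 1) \<notin> epi h" by (simp add: epi_def t0)
  from separating_hyperplane_closed_point[OF cv cl this]
  obtain w \<beta> where sep: "w \<bullet> (z0, t0 - 1) < \<beta>" "\<And>y. y \<in> epi h \<Longrightarrow> \<beta> < w \<bullet> y" by blast
  obtain a b where w: "w = (a, b)" by (cases w)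
  have "\<beta> < a \<bullet> z0 + b * t0" using sep(2)[of "(z0, t0)"] by (simp add: epi_def t0 w)
  with sep(1) have b: "b > 0" by (simp add: w algebra_simps)
  define a' where "a' = a /\<^sub>R b"
  have affine: "\<beta> / b - a' \<bullet> z \<le> t" if "h z \<le> ereal t" for z t
  proof -
    have "\<beta> < a \<bullet> z + b * t" using sep(2)[of "(z, t)"] that by (simp add: epi_def w)
    then show ?thesis using b by (simp add: a'_def field_simps)
  qed
  define proximal_at where
    "proximal_at x p \<longleftrightarrow> \<bar>h p\<bar> \<noteq> \<infinity> \<and> (\<forall>z. h p + ereal ((x - p) \<bullet> (z - p) / \<gamma>) \<le> h z)" for x p
  have "\<exists>p. proximal_at x p" for x
  proof -
    define \<Phi> where "\<Phi> = (\<lambda>(z, t). t + (norm (z - x))\<^sup>2 / (2 * \<gamma>))"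
    define K where "K = \<Phi> (z0, t0)"
    define C where "C = epi h \<inter> {y. \<Phi> y \<le> K}"
    have cont: "continuous_on UNIV \<Phi>"
      unfolding \<Phi>_def case_prod_unfold using \<gamma> by (intro continuous_intros) auto
    have "closed C"
      unfolding C_def using cl cont
      by (intro closed_Int closed_Collect_le continuous_on_const) auto
    moreover have "bounded C"
    proof -
      \<comment> \<open>Completing the square in \<open>\<beta> / b - a' \<bullet> z + |z - x|\<^sup>2 / 2\<gamma> \<le> K\<close> shows that \<open>z\<close> lies in a ball around \<open>c\<close>.\<close>
      define c where "c = x + \<gamma> *\<^sub>R a'"
      define R where "R = 2 * \<gamma> * (K - \<beta> / b + a' \<bullet> x + \<gamma> / 2 * (norm a')\<^sup>2)"
      have z: "(norm (z - c))\<^sup>2 \<le> R" if "(z, t) \<in> C" for z t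
      proof -
        have "\<beta> / b - a' \<bullet> z + (norm (z - x))\<^sup>2 / (2 * \<gamma>) \<le> K"
          using that affine[of z t] by (auto simp: C_def \<Phi>_def epi_def)
        then have "2 * \<gamma> * (\<beta> / b - a' \<bullet> z) + (norm (z - x))\<^sup>2 \<le> 2 * \<gamma> * K"
          using \<gamma> by (simp add: field_simps)
        then show ?thesis
          unfolding R_def c_def power2_norm_eq_inner
          by (simp add: inner_diff_left inner_diff_right inner_add_left inner_add_right
              inner_commute power2_eq_square algebra_simps)
      qed
      have zball: "z \<in> cball c (sqrt R)" if "(z, t) \<in> C" for z t
        using z[OF that] real_le_rsqrt by (simp add: dist_norm norm_minus_commute)
      have "t \<in> {\<beta> / b - norm a' * (norm c + sqrt R) .. K}" if "(z, t) \<in> C" for z t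
      proof -
        have "norm z \<le> norm c + sqrt R"
          using zball[OF that] norm_triangle_sub[of z c] by (simp add: dist_norm norm_minus_commute)
        then have "a' \<bullet> z \<le> norm a' * (norm c + sqrt R)"
          by (meson mult_left_mono norm_cauchy_schwarz norm_ge_zero order_trans)
        moreover have "\<beta> / b - a' \<bullet> z \<le> t" using that affine by (auto simp: C_def epi_def)
        moreover have "0 \<le> (norm (z - x))\<^sup>2 / (2 * \<gamma>)" using \<gamma> by simp
        then have "t \<le> K" using that by (auto simp: C_def \<Phi>_def)
        ultimately show ?thesis by auto
      qed
      with zball have "C \<subseteq> cball c (sqrt R) \<times> {\<beta> / b - norm a' * (norm c + sqrt R) .. K}"
        by auto
      then show ?thesis
        by (rule bounded_subset[rotated]) (intro bounded_Times bounded_cball bounded_closed_interval)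
    qed
    ultimately have "compact C" by (simp add: compact_eq_bounded_closed)
    moreover have in_C: "(z0, t0) \<in> C" by (simp add: C_def epi_def t0 K_def)
    ultimately obtain y where "y \<in> C" and ymin: "\<And>u. u \<in> C \<Longrightarrow> \<Phi> y \<le> \<Phi> u"
      using continuous_attains_inf[of C \<Phi>] continuous_on_subset[OF cont] by (metis empty_iff subset_UNIV)
    obtain p s where y: "y = (p, s)" by (cases y)
    have hp: "h p \<le> ereal s" using \<open>y \<in> C\<close> by (simp add: C_def epi_def y)
    have min: "\<Phi> (p, s) \<le> \<Phi> u" if "u \<in> epi h" for u
      using ymin[of u] ymin[OF in_C] that by (fastforce simp: C_def K_def y)
    have key: "s + (x - p) \<bullet> (z - p) / \<gamma> \<le> t" if "h z \<le> ereal t" for z t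
    proof -
      define A where "A = t - s - (x - p) \<bullet> (z - p) / \<gamma>"
      define B where "B = (norm (z - p))\<^sup>2 / (2 * \<gamma>)"
      \<comment> \<open>\<open>A + r B\<close> is the difference quotient of \<open>\<Phi>\<close> along the segment; let \<open>r\<close> tend to 0.\<close>
      have step: "0 \<le> A + r * B" if r: "0 < r" "r \<le> 1" for r
      proof -
        have "(1 - r) *\<^sub>R (p, s) + r *\<^sub>R (z, t) \<in> epi h"
          using cv hp \<open>h z \<le> ereal t\<close> r by (intro convexD_alt) (auto simp: epi_def)
        from min[OF this]
        have "s + (norm (p - x))\<^sup>2 / (2 * \<gamma>)
            \<le> (1 - r) * s + r * t + (norm ((p - x) + r *\<^sub>R (z - p)))\<^sup>2 / (2 * \<gamma>)"
          by (simp add: \<Phi>_def algebra_simps)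
        also have "(norm ((p - x) + r *\<^sub>R (z - p)))\<^sup>2
            = (norm (p - x))\<^sup>2 - 2 * r * ((x - p) \<bullet> (z - p)) + r\<^sup>2 * (norm (z - p))\<^sup>2"
          unfolding power2_norm_eq_inner
          by (simp add: inner_diff_left inner_diff_right inner_add_left inner_add_right
              inner_commute power2_eq_square algebra_simps)
        also have "\<dots> / (2 * \<gamma>) = (norm (p - x))\<^sup>2 / (2 * \<gamma>)
            - r * ((x - p) \<bullet> (z - p) / \<gamma>) + r * (r * B)"
          using \<gamma> by (simp add: B_def field_simps power2_eq_square)
        finally have "0 \<le> r * (A + r * B)"
          by (simp add: A_def algebra_simps)
        then show ?thesis using r by (simp add: zero_le_mult_iff)
      qed
      have "0 \<le> A"
      proof (rule field_le_epsilon)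
        fix e :: real assume "e > 0"
        have B: "B \<ge> 0" using \<gamma> by (simp add: B_def)
        define r where "r = min 1 (e / (B + 1))"
        have r: "0 < r" "r \<le> 1" using \<open>e > 0\<close> B by (auto simp: r_def)
        have "r * B \<le> e / (B + 1) * (B + 1)"
          using B \<open>e > 0\<close> by (intro mult_mono) (auto simp: r_def)
        also have "\<dots> = e" using B by simp
        finally show "0 \<le> A + e" using step[OF r] by linarith
      qed
      then show ?thesis by (simp add: A_def)
    qed
    have "h p = ereal s"
    proof (cases "h p")
      case (real s') with key[of p s'] hp show ?thesis by simp
    qed (use hp proper[of p] in auto)
    moreover have "ereal s + ereal ((x - p) \<bullet> (z - p) / \<gamma>) \<le> h z" for z
      using key[of z] proper[of z] by (cases "h z") auto
    ultimately show ?thesis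
      by (intro exI[of _ p]) (simp add: proximal_at_def)
  qed
  then obtain P where "\<And>x. proximal_at x (P x)"
    by metis
  then have "proximal_map \<gamma> h P"
    by (simp add: proximal_map_def proximal_at_def)
  then show ?thesis by blast
qed

text \<open>The sum of the subgradient inequalities at \<open>P x\<close> and \<open>P y\<close>, each tested at the other point.\<close>

lemma proximal_map_firmly_nonexpansive:
  assumes P: "proximal_map \<gamma> h P" and \<gamma>: "\<gamma> > 0"
  shows "(norm (P y - P x))\<^sup>2 \<le> (P y - P x) \<bullet> (y - x)"
proof -
  obtain u v where uv: "h (P x) = ereal u" "h (P y) = ereal v"
    using P unfolding proximal_map_def by (metis abs_ereal.simps(1) ereal_infinity_cases not_infty_ereal ereal_cases)
  have "u + (x - P x) \<bullet> (P y - P x) / \<gamma> \<le> v" "v + (y - P y) \<bullet> (P x - P y) / \<gamma> \<le> u"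
    using P uv unfolding proximal_map_def by (metis ereal_less_eq(3) plus_ereal.simps(1))+
  then have "(x - P x) \<bullet> (P y - P x) / \<gamma> + (y - P y) \<bullet> (P x - P y) / \<gamma> \<le> 0"
    by linarith
  then have "(x - P x) \<bullet> (P y - P x) + (y - P y) \<bullet> (P x - P y) \<le> 0"
    using \<gamma> by (simp add: field_simps)
  then show ?thesis
    unfolding power2_norm_eq_inner
    by (simp add: inner_diff_left inner_diff_right inner_commute algebra_simps)
qed

text \<open>The variational inequality makes \<open>P x\<close> a minimizer, so the infimum is attained and finite.\<close>

lemma moreau_env_eq:
  assumes P: "proximal_map \<gamma> h P" and \<gamma>: "\<gamma> > 0"
  shows "moreau_env \<gamma> h x = real_of_ereal (h (P x)) + (norm (x - P x))\<^sup>2 / (2 * \<gamma>)"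
proof -
  obtain u where u: "h (P x) = ereal u"
    using P unfolding proximal_map_def by (metis ereal_cases abs_ereal.simps(2,3))
  have "(INF z. h z + ereal (1 / (2 * \<gamma>) * (norm (z - x))\<^sup>2))
      = ereal (u + (norm (x - P x))\<^sup>2 / (2 * \<gamma>))"
  proof (rule antisym)
    show "(INF z. h z + ereal (1 / (2 * \<gamma>) * (norm (z - x))\<^sup>2))
        \<le> ereal (u + (norm (x - P x))\<^sup>2 / (2 * \<gamma>))"
      by (rule INF_lower2[of "P x"]) (auto simp: u norm_minus_commute)
    show "ereal (u + (norm (x - P x))\<^sup>2 / (2 * \<gamma>))
        \<le> (INF z. h z + ereal (1 / (2 * \<gamma>) * (norm (z - x))\<^sup>2))"
    proof (rule INF_greatest)
      fix z
      have sub: "ereal (u + (x - P x) \<bullet> (z - P x) / \<gamma>) \<le> h z"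
        using P u unfolding proximal_map_def by (metis plus_ereal.simps(1))
      have "(norm (z - x))\<^sup>2
          = (norm (x - P x))\<^sup>2 - 2 * ((x - P x) \<bullet> (z - P x)) + (norm (z - P x))\<^sup>2"
        unfolding power2_norm_eq_inner
        by (simp add: inner_diff_left inner_diff_right inner_commute algebra_simps)
      then have "(norm (x - P x))\<^sup>2 - 2 * ((x - P x) \<bullet> (z - P x)) \<le> (norm (z - x))\<^sup>2"
        by simp
      then have "(norm (x - P x))\<^sup>2 / (2 * \<gamma>)
          \<le> (x - P x) \<bullet> (z - P x) / \<gamma> + 1 / (2 * \<gamma>) * (norm (z - x))\<^sup>2"
        using \<gamma> by (simp add: field_simps)
      then show "ereal (u + (norm (x - P x))\<^sup>2 / (2 * \<gamma>))
          \<le> h z + ereal (1 / (2 * \<gamma>) * (norm (z - x))\<^sup>2)"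
        using sub by (cases "h z") auto
    qed
  qed
  then show ?thesis by (simp add: moreau_env_def u)
qed

text \<open>The subgradient inequality for \<open>h\<close> at \<open>P x\<close>, tested at \<open>P y\<close>, with the squares completed. It says
  that the Moreau envelope has slope \<open>(x - P x) / \<gamma>\<close> at \<open>x\<close>, and the last summand on the left is
  the surplus that \<open>moreau_env_upper\<close> consumes.\<close>

lemma moreau_env_lower:
  assumes P: "proximal_map \<gamma> h P" and \<gamma>: "\<gamma> > 0"
  shows "moreau_env \<gamma> h x + (x - P x) \<bullet> (y - x) / \<gamma> + (norm ((y - P y) - (x - P x)))\<^sup>2 / (2 * \<gamma>)
    \<le> moreau_env \<gamma> h y"
proof -
  obtain u v where uv: "h (P x) = ereal u" "h (P y) = ereal v"
    using P unfolding proximal_map_def by (metis ereal_cases abs_ereal.simps(2,3))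
  have "u + (x - P x) \<bullet> (P y - P x) / \<gamma> \<le> v"
    using P uv unfolding proximal_map_def by (metis ereal_less_eq(3) plus_ereal.simps(1))
  moreover have "(norm (x - P x))\<^sup>2 + 2 * ((x - P x) \<bullet> (y - x)) + (norm ((y - P y) - (x - P x)))\<^sup>2
      = 2 * ((x - P x) \<bullet> (P y - P x)) + (norm (y - P y))\<^sup>2"
    unfolding power2_norm_eq_inner
    by (simp add: inner_diff_left inner_diff_right inner_commute algebra_simps)
  then have "(norm (x - P x))\<^sup>2 / (2 * \<gamma>) + (x - P x) \<bullet> (y - x) / \<gamma>
        + (norm ((y - P y) - (x - P x)))\<^sup>2 / (2 * \<gamma>)
      = (x - P x) \<bullet> (P y - P x) / \<gamma> + (norm (y - P y))\<^sup>2 / (2 * \<gamma>)"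
    using \<gamma> by (simp add: field_simps)
  ultimately show ?thesis
    by (simp add: moreau_env_eq[OF P \<gamma>] uv)
qed

text \<open>Exchanging \<open>x\<close> and \<open>y\<close> in \<open>moreau_env_lower\<close> bounds the envelope at \<open>y\<close> with the slope at \<open>y\<close>.
  Replacing it by the slope at \<open>x\<close> costs an inner product, which Young's inequality splits into the
  quadratic surplus and \<open>|y - x|\<^sup>2 / 2\<gamma>\<close>.\<close>

lemma moreau_env_upper:
  assumes P: "proximal_map \<gamma> h P" and \<gamma>: "\<gamma> > 0"
  shows "moreau_env \<gamma> h y
    \<le> moreau_env \<gamma> h x + (x - P x) \<bullet> (y - x) / \<gamma> + (norm (y - x))\<^sup>2 / (2 * \<gamma>)"
proof -
  define r s d where "r = x - P x" and "s = y - P y" and "d = y - x"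
  have "0 \<le> (norm (s - r - d))\<^sup>2" by simp
  also have "\<dots> = (norm (s - r))\<^sup>2 - 2 * (s \<bullet> d) + 2 * (r \<bullet> d) + (norm d)\<^sup>2"
    unfolding power2_norm_eq_inner
    by (simp add: inner_diff_left inner_diff_right inner_commute algebra_simps)
  finally have "s \<bullet> d / \<gamma> \<le> r \<bullet> d / \<gamma> + (norm d)\<^sup>2 / (2 * \<gamma>) + (norm (s - r))\<^sup>2 / (2 * \<gamma>)"
    using \<gamma> by (simp add: field_simps)
  moreover have "moreau_env \<gamma> h y - s \<bullet> d / \<gamma> + (norm (s - r))\<^sup>2 / (2 * \<gamma>) \<le> moreau_env \<gamma> h x"
    using moreau_env_lower[OF P \<gamma>, of y x]
    by (simp add: r_def s_def d_def norm_minus_commute inner_diff_right diff_divide_distrib)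
  ultimately show ?thesis by (simp add: r_def s_def d_def)
qed

section \<open>Gradients and convexity from quadratic bounds\<close>

lemma gradient_eq:
  assumes "GDERIV \<phi> x :> D"
  shows "gradient \<phi> x = D"
  unfolding gradient_def
proof (rule the_equality)
  show "GDERIV \<phi> x :> D" by (rule assms)
next
  fix E assume "GDERIV \<phi> x :> E"
  then have "(\<lambda>h. h \<bullet> E) = (\<lambda>h. h \<bullet> D)"
    using assms unfolding gderiv_def by (rule has_derivative_unique)
  then have "\<forall>h. h \<bullet> E = h \<bullet> D" by meson
  then show "E = D" unfolding vector_eq_ldot .
qed

lemma GDERIV_of_quadratic_error:
  fixes \<phi> :: "'a::real_inner \<Rightarrow> real"
  assumes err: "\<And>y. \<bar>\<phi> y - \<phi> x - D \<bullet> (y - x)\<bar> \<le> C * (norm (y - x))\<^sup>2"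
  shows "GDERIV \<phi> x :> D"
  unfolding gderiv_def has_derivative_at_alt
proof (intro conjI allI impI bounded_linear_inner_left)
  fix e :: real assume "e > 0"
  define d where "d = e / (\<bar>C\<bar> + 1)"
  have "norm (\<phi> y - \<phi> x - (y - x) \<bullet> D) \<le> e * norm (y - x)" if y: "norm (y - x) < d" for y
  proof -
    have "C * norm (y - x) \<le> (\<bar>C\<bar> + 1) * d"
      by (rule mult_mono) (use y in auto)
    also have "\<dots> = e" by (simp add: d_def)
    finally have "C * norm (y - x) * norm (y - x) \<le> e * norm (y - x)"
      by (rule mult_right_mono) simp
    then show ?thesis
      using err[of y] by (simp add: inner_commute power2_eq_square)
  qed
  moreover have "d > 0" using \<open>e > 0\<close> by (simp add: d_def)
  ultimately show "\<exists>d>0. \<forall>y. norm (y - x) < d \<longrightarrow>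
      norm (\<phi> y - \<phi> x - (y - x) \<bullet> D) \<le> e * norm (y - x)" by blast
qed

lemma GDERIV_moreau_env:
  assumes P: "proximal_map \<gamma> h P" and \<gamma>: "\<gamma> > 0"
  shows "GDERIV (moreau_env \<gamma> h) x :> (x - P x) /\<^sub>R \<gamma>"
proof (rule GDERIV_of_quadratic_error[where C = "1 / (2 * \<gamma>)"])
  fix y
  have "0 \<le> (norm ((y - P y) - (x - P x)))\<^sup>2 / (2 * \<gamma>)" using \<gamma> by simp
  moreover have "((x - P x) /\<^sub>R \<gamma>) \<bullet> (y - x) = (x - P x) \<bullet> (y - x) / \<gamma>"
    by (simp add: divide_inverse)
  ultimately show "\<bar>moreau_env \<gamma> h y - moreau_env \<gamma> h x - ((x - P x) /\<^sub>R \<gamma>) \<bullet> (y - x)\<bar>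
      \<le> 1 / (2 * \<gamma>) * (norm (y - x))\<^sup>2"
    using moreau_env_lower[OF P \<gamma>, of x y] moreau_env_upper[OF P \<gamma>, of y x]
    by simp
qed

text \<open>Subtracting \<open>(m/2) |x|\<^sup>2\<close> turns the supporting paraboloids of curvature \<open>m\<close> into supporting
  affine functions, and a function that has one at every point is convex.\<close>

lemma convex_on_supporting_paraboloids:
  fixes \<phi> :: "'a::real_inner \<Rightarrow> real"
  assumes supp: "\<And>x y. \<phi> x + D x \<bullet> (y - x) + m / 2 * (norm (y - x))\<^sup>2 \<le> \<phi> y"
  shows "convex_on UNIV (\<lambda>x. \<phi> x - 1 / 2 * m * (norm x)\<^sup>2)"
proof -
  define \<psi> where "\<psi> x = \<phi> x - 1 / 2 * m * (norm x)\<^sup>2" for x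
  have aff: "\<psi> x + (D x - m *\<^sub>R x) \<bullet> (y - x) \<le> \<psi> y" for x y
    using supp[of x y] unfolding \<psi>_def power2_norm_eq_inner
    by (simp add: inner_diff_left inner_diff_right inner_commute algebra_simps)
  have "convex_on UNIV \<psi>"
  proof (rule convex_onI)
    fix t :: real and x y :: 'a
    assume t: "0 < t" "t < 1"
    define z where "z = (1 - t) *\<^sub>R x + t *\<^sub>R y"
    define E where "E = D z - m *\<^sub>R z"
    have "(1 - t) * (\<psi> z + E \<bullet> (x - z)) + t * (\<psi> z + E \<bullet> (y - z)) \<le> (1 - t) * \<psi> x + t * \<psi> y"
      using t aff[of z] by (intro add_mono mult_left_mono) (auto simp: E_def)
    also have "(1 - t) * (\<psi> z + E \<bullet> (x - z)) + t * (\<psi> z + E \<bullet> (y - z))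
        = \<psi> z + E \<bullet> ((1 - t) *\<^sub>R (x - z) + t *\<^sub>R (y - z))"
      by (simp add: inner_add_right algebra_simps)
    also have "(1 - t) *\<^sub>R (x - z) + t *\<^sub>R (y - z) = 0"
      by (simp add: z_def algebra_simps)
    finally show "\<psi> ((1 - t) *\<^sub>R x + t *\<^sub>R y) \<le> (1 - t) * \<psi> x + t * \<psi> y"
      by (simp add: z_def)
  qed simp
  then show ?thesis by (simp add: \<psi>_def[abs_def])
qed

section \<open>The Douglas-Rachford envelope of a quadratic\<close>

text \<open>\<open>I + \<gamma> T\<close> is injective because \<open>x \<bullet> (x + \<gamma> T x) \<ge> |x|\<^sup>2\<close>; its inverse inherits self-adjointness.\<close>

lemma resolvent_exists:
  fixes T :: "'a::euclidean_space \<Rightarrow> 'a"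
  assumes T: "self_adjoint T" and nonneg: "\<And>x. 0 \<le> x \<bullet> T x" and \<gamma>: "\<gamma> \<ge> 0"
  obtains M where "self_adjoint M" "\<And>x. M x + \<gamma> *\<^sub>R T (M x) = x"
proof -
  define B where "B x = x + \<gamma> *\<^sub>R T x" for x
  have B: "self_adjoint B"
    unfolding self_adjoint_def
  proof (intro conjI allI)
    show "linear B"
      unfolding B_def[abs_def]
      by (rule linear_compose_add[OF linear_ident
            linear_compose_scale_right[OF self_adjoint_linear[OF T]]])
    show "B x \<bullet> y = x \<bullet> B y" for x y
      by (simp add: B_def inner_add_left inner_add_right self_adjoint_swap[OF T])
  qed
  have "x = 0" if "B x = 0" for x
  proof -
    have "x \<bullet> B x = x \<bullet> x + \<gamma> * (x \<bullet> T x)"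
      by (simp add: B_def inner_add_right)
    then have "x \<bullet> x + \<gamma> * (x \<bullet> T x) = 0"
      using that by simp
    moreover have "0 \<le> \<gamma> * (x \<bullet> T x)" "0 \<le> x \<bullet> x"
      using nonneg[of x] \<gamma> by simp_all
    ultimately have "x \<bullet> x = 0" by linarith
    then show ?thesis by simp
  qed
  then have "inj B"
    using linear_injective_0 self_adjoint_linear[OF B] by blast
  then obtain M where M: "linear M" "\<And>x. B (M x) = x"
    using linear_injective_isomorphism self_adjoint_linear[OF B] by metis
  have "self_adjoint M"
    unfolding self_adjoint_def using M self_adjoint_swap[OF B] by metis
  then show thesis using that M(2) by (simp add: B_def)
qed

text \<open>The equation for \<open>P x\<close> says that \<open>(x - P x) / \<gamma>\<close> is the gradient of the convex quadratic at \<open>P x\<close>,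
  and gradients of convex functions are subgradients.\<close>

lemma proximal_map_quadratic:
  assumes T: "self_adjoint T" and nonneg: "\<And>x. 0 \<le> x \<bullet> T x" and \<gamma>: "\<gamma> > 0"
    and P: "\<And>x. P x + \<gamma> *\<^sub>R (T (P x) + q) = x"
  shows "proximal_map \<gamma> (\<lambda>x. ereal (1 / 2 * (x \<bullet> T x) + q \<bullet> x)) P"
  unfolding proximal_map_def
proof (intro allI conjI)
  fix x z
  define d where "d = z - P x"
  have "(x - P x) \<bullet> d = \<gamma> * ((T (P x) + q) \<bullet> d)"
    by (metis P add_diff_cancel_left' inner_scaleR_left)
  then have grad: "(x - P x) \<bullet> d / \<gamma> = (T (P x) + q) \<bullet> d"
    using \<gamma> by simp
  have "1 / 2 * ((P x + d) \<bullet> T (P x + d)) + q \<bullet> (P x + d)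
      = 1 / 2 * (P x \<bullet> T (P x)) + q \<bullet> P x + (T (P x) + q) \<bullet> d + 1 / 2 * (d \<bullet> T d)"
    using self_adjoint_swap[OF T, of d "P x"]
    by (simp add: linear_add[OF self_adjoint_linear[OF T]] inner_add_left inner_add_right
        inner_commute algebra_simps)
  then show "ereal (1 / 2 * (P x \<bullet> T (P x)) + q \<bullet> P x) + ereal ((x - P x) \<bullet> (z - P x) / \<gamma>)
      \<le> ereal (1 / 2 * (z \<bullet> T z) + q \<bullet> z)"
    using grad nonneg[of d] by (simp add: d_def)
qed simp

text \<open>The setting of the theorem for a self-adjoint operator \<open>T\<close> in place of the matrix: \<open>M\<close> is the
  resolvent \<open>(I + \<gamma> T)\<^sup>-\<^sup>1\<close>, \<open>G\<close> the proximal map of \<open>g\<close>, and \<open>[\<mu>, L]\<close> contains the spectrum of \<open>T\<close>.\<close>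

locale quadratic_douglas_rachford =
  fixes T M :: "'a::euclidean_space \<Rightarrow> 'a" and q :: 'a and g :: "'a \<Rightarrow> ereal" and G :: "'a \<Rightarrow> 'a"
    and \<gamma> \<mu> L :: real
  assumes T: "self_adjoint T" and M: "self_adjoint M"
    and resolvent: "\<And>x. M x + \<gamma> *\<^sub>R T (M x) = x"
    and lower: "\<And>x. \<mu> * (norm x)\<^sup>2 \<le> x \<bullet> T x" and upper: "\<And>x. x \<bullet> T x \<le> L * (norm x)\<^sup>2"
    and \<mu>: "0 \<le> \<mu>" and \<mu>L: "\<mu> \<le> L" and \<gamma>: "0 < \<gamma>" and \<gamma>L: "\<gamma> * L < 1"
    and G: "proximal_map \<gamma> g G"
begin

definition f :: "'a \<Rightarrow> real" where "f x = 1 / 2 * (x \<bullet> T x) + q \<bullet> x"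
definition prox :: "'a \<Rightarrow> 'a" where "prox x = M (x - \<gamma> *\<^sub>R q)"

text \<open>The linear part of the reflected proximal map \<open>x \<mapsto> 2 prox x - x\<close>.\<close>

definition reflect :: "'a \<Rightarrow> 'a" where "reflect u = 2 *\<^sub>R M u - u"

text \<open>The gradient of the envelope. With \<open>a\<close> the gradient of \<open>f\<close> at \<open>prox x\<close> and \<open>s / \<gamma>\<close> the gradient of the
  Moreau envelope of \<open>g\<close> at \<open>2 prox x - x\<close>, the chain rule gives \<open>reflect (a + s / \<gamma>)\<close>, and
  \<open>\<gamma> a + s\<close> collapses to the difference of the two proximal points.\<close>

definition env_grad :: "'a \<Rightarrow> 'a" where "env_grad x = reflect (prox x - G (2 *\<^sub>R prox x - x)) /\<^sub>R \<gamma>"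

text \<open>As a function of \<open>T\<close>, \<open>reflect\<close> is \<open>(1 - \<gamma>t) / (1 + \<gamma>t)\<close>, which is largest at the lower end \<open>\<mu>\<close> of the
  spectrum.\<close>

definition \<alpha> :: real where "\<alpha> = (1 - \<gamma> * \<mu>) / (1 + \<gamma> * \<mu>)"

text \<open>A lower bound for the eigenvalues of the Hessian of the quadratic part of the envelope.\<close>

definition \<kappa> :: real where
  "\<kappa> = min ((1 - \<gamma> * \<mu>) * \<mu> / (1 + \<gamma> * \<mu>)\<^sup>2) ((1 - \<gamma> * L) * L / (1 + \<gamma> * L)\<^sup>2)"

lemma form_nonneg: "0 \<le> x \<bullet> T x"
  by (rule order_trans[OF mult_nonneg_nonneg[OF \<mu> zero_le_power2] lower])

lemma scaled_bounds: "0 \<le> \<gamma> * \<mu>" "\<gamma> * \<mu> \<le> \<gamma> * L" "\<gamma> * \<mu> < 1" "0 \<le> \<gamma> * L"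
proof -
  show "0 \<le> \<gamma> * \<mu>" "0 \<le> \<gamma> * L" using \<mu> \<mu>L \<gamma> by simp_all
  show "\<gamma> * \<mu> \<le> \<gamma> * L" using \<mu>L \<gamma> by simp
  then show "\<gamma> * \<mu> < 1" using \<gamma>L by linarith
qed

lemma prox_eq: "prox x + \<gamma> *\<^sub>R (T (prox x) + q) = x"
  using resolvent[of "x - \<gamma> *\<^sub>R q"] by (simp add: prox_def algebra_simps)

lemma prox_diff: "prox y - prox x = M (y - x)"
  by (simp add: prox_def flip: linear_diff[OF self_adjoint_linear[OF M]])

lemma reflect_self_adjoint: "self_adjoint reflect"
  unfolding self_adjoint_def
proof (intro conjI allI)
  show "linear reflect"
    unfolding reflect_def[abs_def]
    by (rule linear_compose_sub[OF linear_compose_scale_right[OF self_adjoint_linear[OF M]]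
          linear_ident])
  show "reflect x \<bullet> y = x \<bullet> reflect y" for x y
    by (simp add: reflect_def inner_diff_left inner_diff_right self_adjoint_swap[OF M])
qed

lemma reflect_diff: "reflect (y - x) = (2 *\<^sub>R prox y - y) - (2 *\<^sub>R prox x - x)"
  by (simp add: reflect_def algebra_simps flip: prox_diff)

lemma reflect_eq: "reflect u = M u - \<gamma> *\<^sub>R T (M u)"
  using resolvent[of u] by (simp add: reflect_def algebra_simps scaleR_2)

lemma proximal_map_f: "proximal_map \<gamma> (\<lambda>x. ereal (f x)) prox"
  unfolding f_def by (rule proximal_map_quadratic[OF T form_nonneg \<gamma> prox_eq])

lemma alpha_bounds: "0 \<le> \<alpha>" "\<alpha> \<le> 1"
  using scaled_bounds by (auto simp: \<alpha>_def divide_simps)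

lemma kappa_nonneg: "0 \<le> \<kappa>"
  using scaled_bounds \<mu> \<mu>L \<gamma>L by (auto simp: \<kappa>_def)

text \<open>Put \<open>u = v + \<gamma> T v\<close>, so that \<open>reflect u = v - \<gamma> T v\<close>. The claim is that the polynomial
  \<open>\<alpha>\<^sup>2 (1 + \<gamma>t)\<^sup>2 - (1 - \<gamma>t)\<^sup>2\<close> of \<open>T\<close> is positive semidefinite. It is concave as \<open>\<alpha> \<le> 1\<close>,
  vanishes at \<open>\<mu>\<close> by the choice of \<open>\<alpha>\<close>, and is nonnegative at \<open>L\<close> because \<open>(1 - \<gamma>t) / (1 + \<gamma>t)\<close>
  decreases in \<open>t\<close>.\<close>

lemma norm_reflect_le: "norm (reflect u) \<le> \<alpha> * norm u"
proof (rule power2_le_imp_le)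
  define v where "v = M u"
  have eq: "\<alpha> * (1 + \<gamma> * \<mu>) = 1 - \<gamma> * \<mu>"
    using scaled_bounds by (simp add: \<alpha>_def)
  have "(1 - \<gamma> * L) * (1 + \<gamma> * \<mu>) \<le> (1 - \<gamma> * \<mu>) * (1 + \<gamma> * L)"
    using scaled_bounds by (simp add: algebra_simps)
  then have "1 - \<gamma> * L \<le> \<alpha> * (1 + \<gamma> * L)"
    using scaled_bounds by (simp add: \<alpha>_def field_simps)
  then have le: "(1 - \<gamma> * L)\<^sup>2 \<le> (\<alpha> * (1 + \<gamma> * L))\<^sup>2"
    using \<gamma>L by (intro power_mono) auto
  have "\<alpha>\<^sup>2 \<le> 1" using alpha_bounds by (simp add: power_le_one)
  have "0 \<le> (\<alpha>\<^sup>2 - 1) * (norm v)\<^sup>2 + (2 * \<gamma> * (\<alpha>\<^sup>2 + 1)) * (v \<bullet> T v) + (\<gamma>\<^sup>2 * (\<alpha>\<^sup>2 - 1)) * (norm (T v))\<^sup>2"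
  proof (rule concave_polynomial_form_nonneg[OF T lower upper])
    show "\<gamma>\<^sup>2 * (\<alpha>\<^sup>2 - 1) \<le> 0" using \<open>\<alpha>\<^sup>2 \<le> 1\<close> by (simp add: mult_nonneg_nonpos)
    have "\<alpha>\<^sup>2 - 1 + 2 * \<gamma> * (\<alpha>\<^sup>2 + 1) * t + \<gamma>\<^sup>2 * (\<alpha>\<^sup>2 - 1) * t\<^sup>2
        = (\<alpha> * (1 + \<gamma> * t))\<^sup>2 - (1 - \<gamma> * t)\<^sup>2" for t
      by (simp add: power2_eq_square algebra_simps)
    then show "0 \<le> \<alpha>\<^sup>2 - 1 + 2 * \<gamma> * (\<alpha>\<^sup>2 + 1) * \<mu> + \<gamma>\<^sup>2 * (\<alpha>\<^sup>2 - 1) * \<mu>\<^sup>2"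
      "0 \<le> \<alpha>\<^sup>2 - 1 + 2 * \<gamma> * (\<alpha>\<^sup>2 + 1) * L + \<gamma>\<^sup>2 * (\<alpha>\<^sup>2 - 1) * L\<^sup>2"
      using eq le by simp_all
  qed
  also have "\<dots> = \<alpha>\<^sup>2 * (norm (v + \<gamma> *\<^sub>R T v))\<^sup>2 - (norm (v - \<gamma> *\<^sub>R T v))\<^sup>2"
    unfolding power2_norm_eq_inner
    by (simp add: inner_diff_left inner_diff_right inner_add_left inner_add_right
        inner_commute[of "T v" v] power2_eq_square algebra_simps)
  finally show "(norm (reflect u))\<^sup>2 \<le> (\<alpha> * norm u)\<^sup>2"
    using resolvent[of u] by (simp add: reflect_eq v_def power_mult_distrib)
qed (use alpha_bounds in simp)

text \<open>With \<open>v = M u\<close>, and so \<open>u = v + \<gamma> T v\<close>, this is positive semidefiniteness of the polynomial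
  \<open>t (1 - \<gamma>t) - \<kappa> (1 + \<gamma>t)\<^sup>2\<close> of \<open>T\<close>. It is concave, and \<open>\<kappa>\<close> is the largest constant for which it is
  nonnegative at both \<open>\<mu>\<close> and \<open>L\<close>.\<close>

lemma kappa_le_form: "\<kappa> * (norm u)\<^sup>2 \<le> M u \<bullet> T (M u) - \<gamma> * (norm (T (M u)))\<^sup>2"
proof -
  define v where "v = M u"
  have eq: "- \<kappa> + (1 - 2 * \<gamma> * \<kappa>) * t + (- \<gamma> - \<kappa> * \<gamma>\<^sup>2) * t\<^sup>2
      = (1 - \<gamma> * t) * t - \<kappa> * (1 + \<gamma> * t)\<^sup>2" for t
    by (simp add: power2_eq_square algebra_simps)
  have le: "\<kappa> * (1 + \<gamma> * t)\<^sup>2 \<le> (1 - \<gamma> * t) * t" if "t \<in> {\<mu>, L}" for t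
  proof -
    have "1 + \<gamma> * t > 0" using that scaled_bounds by auto
    moreover have "\<kappa> \<le> (1 - \<gamma> * t) * t / (1 + \<gamma> * t)\<^sup>2" using that by (auto simp: \<kappa>_def)
    ultimately show ?thesis by (simp add: field_simps)
  qed
  have "0 \<le> - \<kappa> * (norm v)\<^sup>2 + (1 - 2 * \<gamma> * \<kappa>) * (v \<bullet> T v) + (- \<gamma> - \<kappa> * \<gamma>\<^sup>2) * (norm (T v))\<^sup>2"
  proof (rule concave_polynomial_form_nonneg[OF T lower upper])
    have "0 \<le> \<kappa> * \<gamma>\<^sup>2" using kappa_nonneg by simp
    then show "- \<gamma> - \<kappa> * \<gamma>\<^sup>2 \<le> 0" using \<gamma> by linarith
  qed (use le eq in simp_all)
  also have "\<dots> = v \<bullet> T v - \<gamma> * (norm (T v))\<^sup>2 - \<kappa> * (norm (v + \<gamma> *\<^sub>R T v))\<^sup>2"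
    unfolding power2_norm_eq_inner
    by (simp add: inner_add_left inner_add_right inner_commute[of "T v" v]
        power2_eq_square algebra_simps)
  finally show ?thesis
    using resolvent[of u] by (simp add: v_def)
qed

abbreviation F :: "'a \<Rightarrow> real" where "F \<equiv> dr_env \<gamma> (\<lambda>x. ereal (f x)) g"

text \<open>Evaluating the envelope of \<open>f\<close> at \<open>x\<close> gives \<open>f(prox x) + (\<gamma>/2) |a|\<^sup>2\<close> with
  \<open>a = \<nabla>f(prox x) = \<nabla>f\<^sup>\<gamma>(x)\<close>, and subtracting \<open>\<gamma> |a|\<^sup>2\<close> changes the sign of the second summand.\<close>

lemma F_eq:
  "F x = f (prox x) - \<gamma> / 2 * (norm (T (prox x) + q))\<^sup>2 + moreau_env \<gamma> g (2 *\<^sub>R prox x - x)"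
proof -
  have residual: "x - prox x = \<gamma> *\<^sub>R (T (prox x) + q)"
    using prox_eq[of x] by (simp add: algebra_simps)
  then have grad: "gradient (moreau_env \<gamma> (\<lambda>x. ereal (f x))) x = T (prox x) + q"
    using gradient_eq[OF GDERIV_moreau_env[OF proximal_map_f \<gamma>, of x]] \<gamma> by simp
  have "moreau_env \<gamma> (\<lambda>x. ereal (f x)) x = f (prox x) + \<gamma> / 2 * (norm (T (prox x) + q))\<^sup>2"
    using \<gamma> by (simp add: moreau_env_eq[OF proximal_map_f \<gamma>] residual power_mult_distrib power2_eq_square)
  moreover have "x - (2 * \<gamma>) *\<^sub>R (T (prox x) + q) = 2 *\<^sub>R prox x - x"
  proof -
    have "(2 * \<gamma>) *\<^sub>R (T (prox x) + q) = 2 *\<^sub>R (x - prox x)"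
      by (simp add: residual)
    then show ?thesis by (simp add: scaleR_2 algebra_simps)
  qed
  ultimately show ?thesis
    by (simp add: dr_env_def grad)
qed

text \<open>The exact remainder of the first-order expansion: a quadratic form coming from \<open>f\<close>, and the
  first-order remainder of the Moreau envelope of \<open>g\<close> along the reflected points. Both the convexity
  modulus and differentiability are read off from it.\<close>

lemma F_expansion:
  "F y - F x - env_grad x \<bullet> (y - x)
    = 1 / 2 * (M (y - x) \<bullet> T (M (y - x)) - \<gamma> * (norm (T (M (y - x))))\<^sup>2)
      + (moreau_env \<gamma> g (2 *\<^sub>R prox y - y) - moreau_env \<gamma> g (2 *\<^sub>R prox x - x)
         - (2 *\<^sub>R prox x - x - G (2 *\<^sub>R prox x - x)) \<bullet> reflect (y - x) / \<gamma>)"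
proof -
  define v a s where "v = M (y - x)" and "a = T (prox x) + q"
    and "s = 2 *\<^sub>R prox x - x - G (2 *\<^sub>R prox x - x)"
  have py: "prox y = prox x + v" using prox_diff[of y x] by (simp add: v_def algebra_simps)
  have lin: "T (prox x + v) = T (prox x) + T v"
    by (rule linear_add[OF self_adjoint_linear[OF T]])
  have "f (prox y) = f (prox x) + a \<bullet> v + 1 / 2 * (v \<bullet> T v)"
    using self_adjoint_swap[OF T, of v "prox x"]
    unfolding f_def py a_def lin
    by (simp add: inner_add_left inner_add_right inner_commute algebra_simps)
  moreover have "(norm (T (prox y) + q))\<^sup>2 = (norm a)\<^sup>2 + 2 * (a \<bullet> T v) + (norm (T v))\<^sup>2"
    unfolding power2_norm_eq_inner py lin a_def
    by (simp add: inner_add_left inner_add_right inner_commute algebra_simps)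
  moreover have "env_grad x \<bullet> (y - x) = a \<bullet> v - \<gamma> * (a \<bullet> T v) + s \<bullet> reflect (y - x) / \<gamma>"
  proof -
    have "prox x - G (2 *\<^sub>R prox x - x) = \<gamma> *\<^sub>R a + s"
      using prox_eq[of x] by (simp add: a_def s_def algebra_simps scaleR_2)
    then have "env_grad x \<bullet> (y - x) = (\<gamma> *\<^sub>R a + s) \<bullet> reflect (y - x) / \<gamma>"
      by (simp add: env_grad_def self_adjoint_swap[OF reflect_self_adjoint] divide_inverse_commute)
    also have "\<dots> = a \<bullet> reflect (y - x) + s \<bullet> reflect (y - x) / \<gamma>"
      using \<gamma> by (simp add: inner_add_left add_divide_distrib)
    finally show ?thesis by (simp add: reflect_eq v_def inner_diff_right)
  qed
  ultimately show ?thesis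
    unfolding F_eq a_def[symmetric] v_def[symmetric] s_def[symmetric]
    by (simp add: algebra_simps)
qed

lemma F_lower: "F x + env_grad x \<bullet> (y - x) + \<kappa> / 2 * (norm (y - x))\<^sup>2 \<le> F y"
proof -
  have "0 \<le> (norm ((2 *\<^sub>R prox y - y - G (2 *\<^sub>R prox y - y))
      - (2 *\<^sub>R prox x - x - G (2 *\<^sub>R prox x - x))))\<^sup>2 / (2 * \<gamma>)"
    using \<gamma> by simp
  moreover have "\<kappa> / 2 * (norm (y - x))\<^sup>2
      \<le> 1 / 2 * (M (y - x) \<bullet> T (M (y - x)) - \<gamma> * (norm (T (M (y - x))))\<^sup>2)"
    using kappa_le_form[of "y - x"] by simp
  ultimately show ?thesis
    using F_expansion[of y x]
      moreau_env_lower[OF G \<gamma>, of "2 *\<^sub>R prox x - x" "2 *\<^sub>R prox y - y"]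
    unfolding reflect_diff[symmetric] by linarith
qed

text \<open>\<open>M u\<close> is the midpoint of \<open>u\<close> and \<open>reflect u\<close>.\<close>

lemma norm_M_le: "norm (M u) \<le> norm u"
proof -
  have "M u = (1 / 2) *\<^sub>R (u + reflect u)" by (simp add: reflect_def)
  then have "norm (M u) \<le> 1 / 2 * (norm u + norm (reflect u))"
    using norm_triangle_ineq[of u "reflect u"] by simp
  moreover have "norm (reflect u) \<le> norm u"
    using norm_reflect_le[of u] alpha_bounds mult_right_mono[of \<alpha> 1 "norm u"] by simp
  ultimately show ?thesis by simp
qed

text \<open>Put \<open>v = M (y - x)\<close>. The quadratic form of \<open>f\<close> and the upper bound for the Moreau envelope of \<open>g\<close>
  add up to \<open>|v|\<^sup>2 / 2\<gamma> - v \<bullet> T v / 2\<close>, since the terms in \<open>|T v|\<^sup>2\<close> cancel.\<close>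

lemma F_upper: "F y \<le> F x + env_grad x \<bullet> (y - x) + (norm (y - x))\<^sup>2 / (2 * \<gamma>)"
proof -
  define v where "v = M (y - x)"
  have "(norm (reflect (y - x)))\<^sup>2 = (norm v)\<^sup>2 - 2 * \<gamma> * (v \<bullet> T v) + \<gamma>\<^sup>2 * (norm (T v))\<^sup>2"
    unfolding power2_norm_eq_inner
    by (simp add: reflect_eq v_def inner_diff_left inner_diff_right inner_commute power2_eq_square algebra_simps)
  then have "(norm (reflect (y - x)))\<^sup>2 / (2 * \<gamma>)
      = ((norm v)\<^sup>2 - 2 * \<gamma> * (v \<bullet> T v) + \<gamma>\<^sup>2 * (norm (T v))\<^sup>2) / (2 * \<gamma>)"
    by simp
  also have "\<dots> = (norm v)\<^sup>2 / (2 * \<gamma>) - v \<bullet> T v + \<gamma> / 2 * (norm (T v))\<^sup>2"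
    using \<gamma> by (simp add: field_simps power2_eq_square)
  finally have "1 / 2 * (v \<bullet> T v - \<gamma> * (norm (T v))\<^sup>2) + (norm (reflect (y - x)))\<^sup>2 / (2 * \<gamma>)
      = (norm v)\<^sup>2 / (2 * \<gamma>) - 1 / 2 * (v \<bullet> T v)"
    by (simp add: algebra_simps)
  also have "\<dots> \<le> (norm v)\<^sup>2 / (2 * \<gamma>)"
    using form_nonneg[of v] by simp
  also have "\<dots> \<le> (norm (y - x))\<^sup>2 / (2 * \<gamma>)"
    using norm_M_le[of "y - x"] \<gamma> by (intro divide_right_mono power_mono) (auto simp: v_def)
  finally show ?thesis
    using F_expansion[of y x] moreau_env_upper[OF G \<gamma>, of "2 *\<^sub>R prox y - y" "2 *\<^sub>R prox x - x"]
    unfolding reflect_diff[symmetric] v_def[symmetric] by linarith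
qed

lemma F_gradient: "GDERIV F x :> env_grad x"
proof (rule GDERIV_of_quadratic_error[where C = "1 / (2 * \<gamma>)"])
  fix y
  have "0 \<le> \<kappa> / 2 * (norm (y - x))\<^sup>2" using kappa_nonneg by simp
  then show "\<bar>F y - F x - env_grad x \<bullet> (y - x)\<bar> \<le> 1 / (2 * \<gamma>) * (norm (y - x))\<^sup>2"
    using F_lower[of x y] F_upper[of y x] by simp
qed

lemma F_strongly_convex: "convex_on UNIV (\<lambda>x. F x - 1 / 2 * \<kappa> * (norm x)\<^sup>2)"
  by (rule convex_on_supporting_paraboloids[OF F_lower])

lemma F_convex: "convex_on UNIV F"
proof -
  have "F x + env_grad x \<bullet> (y - x) + 0 / 2 * (norm (y - x))\<^sup>2 \<le> F y" for x y
  proof -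
    have "0 \<le> \<kappa> / 2 * (norm (y - x))\<^sup>2" using kappa_nonneg by simp
    then show ?thesis using F_lower[of x y] by simp
  qed
  from convex_on_supporting_paraboloids[OF this] show ?thesis by simp
qed

text \<open>Firm nonexpansiveness of \<open>G\<close> says that \<open>w - 2\<pi>\<close> is no longer than \<open>w\<close>. Writing \<open>M u - \<pi>\<close> as the
  midpoint of \<open>u\<close> and \<open>w - 2\<pi>\<close> keeps its norm below that of \<open>u\<close>, so that only one factor \<open>\<alpha>\<close>, from
  the outer \<open>reflect\<close>, enters the constant.\<close>

lemma env_grad_lipschitz: "(\<alpha> * inverse \<gamma>)-lipschitz_on UNIV env_grad"
proof (rule lipschitz_onI)
  fix x y
  define u w \<pi> where "u = x - y" and "w = reflect u"
    and "\<pi> = G (2 *\<^sub>R prox x - x) - G (2 *\<^sub>R prox y - y)"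
  have "(norm \<pi>)\<^sup>2 \<le> \<pi> \<bullet> w"
    using proximal_map_firmly_nonexpansive[OF G \<gamma>, of "2 *\<^sub>R prox x - x" "2 *\<^sub>R prox y - y"]
    by (simp add: \<pi>_def w_def u_def reflect_diff)
  then have "(norm (w - 2 *\<^sub>R \<pi>))\<^sup>2 \<le> (norm w)\<^sup>2"
    unfolding power2_norm_eq_inner
    by (simp add: inner_diff_left inner_diff_right inner_commute)
  then have reflection: "norm (w - 2 *\<^sub>R \<pi>) \<le> norm w"
    by (rule power2_le_imp_le) simp
  have "norm w \<le> norm u"
    using norm_reflect_le[of u] alpha_bounds mult_right_mono[of \<alpha> 1 "norm u"] by (simp add: w_def)
  have "M u - \<pi> = (1 / 2) *\<^sub>R (u + (w - 2 *\<^sub>R \<pi>))"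
    by (simp add: w_def reflect_def algebra_simps)
  then have "norm (M u - \<pi>) \<le> norm u"
    using norm_triangle_ineq[of u "w - 2 *\<^sub>R \<pi>"] reflection \<open>norm w \<le> norm u\<close> by simp
  then have "\<alpha> * norm (M u - \<pi>) \<le> \<alpha> * norm u"
    using alpha_bounds by (intro mult_left_mono)
  with norm_reflect_le[of "M u - \<pi>"] have "norm (reflect (M u - \<pi>)) \<le> \<alpha> * norm u"
    by linarith
  moreover have "env_grad x - env_grad y = reflect (M u - \<pi>) /\<^sub>R \<gamma>"
  proof -
    have "M u - \<pi> = (prox x - G (2 *\<^sub>R prox x - x)) - (prox y - G (2 *\<^sub>R prox y - y))"
      by (simp add: u_def \<pi>_def algebra_simps flip: prox_diff)
    then show ?thesis
      by (simp add: env_grad_def linear_diff[OF self_adjoint_linear[OF reflect_self_adjoint]]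
          scaleR_right_diff_distrib)
  qed
  ultimately show "dist (env_grad x) (env_grad y) \<le> \<alpha> * inverse \<gamma> * dist x y"
    using \<gamma> by (simp add: dist_norm u_def divide_simps)
qed (use alpha_bounds \<gamma> in simp)

end

theorem theorem2:
  fixes Q :: "real ^ 'n ^ 'n" and q :: "real ^ 'n"
    and g :: "real ^ 'n \<Rightarrow> ereal" and \<gamma> :: real
  defines "f \<equiv> \<lambda>x. ereal (quadratic Q q x)"
    and "\<mu>\<^sub>f \<equiv> eig_min Q" and "L\<^sub>f \<equiv> eig_max Q"
  defines "F_DR \<equiv> dr_env \<gamma> f g"
    and "L_DR \<equiv> (1 - \<gamma> * \<mu>\<^sub>f) / (1 + \<gamma> * \<mu>\<^sub>f) * inverse \<gamma>"
    and "\<mu>_DR \<equiv> min ((1 - \<gamma> * \<mu>\<^sub>f) * \<mu>\<^sub>f / (1 + \<gamma> * \<mu>\<^sub>f)\<^sup>2)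
                     ((1 - \<gamma> * L\<^sub>f) * L\<^sub>f / (1 + \<gamma> * L\<^sub>f)\<^sup>2)"
  assumes "psd Q"
    and "proper_closed_convex g"
    and "minimizers (\<lambda>x. f x + g x) \<noteq> {}"
    and "0 < \<gamma>" and "L\<^sub>f \<noteq> 0 \<longrightarrow> \<gamma> < 1 / L\<^sub>f"
  shows "convex_on UNIV F_DR
    \<and> (\<forall>x. \<exists>D. GDERIV F_DR x :> D)
    \<and> L_DR-lipschitz_on UNIV (gradient F_DR)
    \<and> convex_on UNIV (\<lambda>x. F_DR x - 1 / 2 * \<mu>_DR * (norm x)\<^sup>2)"
proof -
  have sym: "transpose Q = Q" and nonneg: "\<And>x. 0 \<le> x \<bullet> (Q *v x)"
    using \<open>psd Q\<close> by (auto simp: psd_def)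
  have lower: "\<mu>\<^sub>f * (norm x)\<^sup>2 \<le> x \<bullet> (Q *v x)" and upper: "x \<bullet> (Q *v x) \<le> L\<^sub>f * (norm x)\<^sup>2" for x
    unfolding \<mu>\<^sub>f_def L\<^sub>f_def by (rule eig_min_le_form(2)[OF sym], rule form_le_eig_max[OF sym])
  obtain v where v: "v \<noteq> 0" "Q *v v = \<mu>\<^sub>f *\<^sub>R v"
    using eig_min_le_form(1)[OF sym] unfolding \<mu>\<^sub>f_def eigenvalues_def by blast
  have "0 \<le> \<mu>\<^sub>f * (v \<bullet> v)" "\<mu>\<^sub>f * (v \<bullet> v) \<le> L\<^sub>f * (v \<bullet> v)"
    using nonneg[of v] upper[of v] v(2) by (simp_all add: power2_norm_eq_inner)
  moreover have "0 < v \<bullet> v" using v(1) by simp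
  ultimately have \<mu>: "0 \<le> \<mu>\<^sub>f" and \<mu>L: "\<mu>\<^sub>f \<le> L\<^sub>f"
    by (simp_all add: zero_le_mult_iff)
  have \<gamma>L: "\<gamma> * L\<^sub>f < 1"
  proof (cases "L\<^sub>f = 0")
    case False
    with \<mu> \<mu>L have "0 < L\<^sub>f" by linarith
    with False \<open>L\<^sub>f \<noteq> 0 \<longrightarrow> \<gamma> < 1 / L\<^sub>f\<close> show ?thesis by (simp add: pos_less_divide_eq)
  qed simp
  obtain M where M: "self_adjoint M" "\<And>x. M x + \<gamma> *\<^sub>R (Q *v M x) = x"
    using resolvent_exists[OF self_adjoint_matrix[OF sym] nonneg less_imp_le[OF \<open>0 < \<gamma>\<close>]] by metis
  obtain G where G: "proximal_map \<gamma> g G"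
    using proximal_map_exists[OF \<open>proper_closed_convex g\<close> \<open>0 < \<gamma>\<close>] by blast
  interpret dr: quadratic_douglas_rachford "(*v) Q" M q g G \<gamma> \<mu>\<^sub>f L\<^sub>f
    by unfold_locales (use self_adjoint_matrix[OF sym] M lower upper \<mu> \<mu>L \<open>0 < \<gamma>\<close> \<gamma>L G in auto)
  have F: "F_DR = dr.F"
    by (simp add: F_DR_def f_def quadratic_def dr.f_def[abs_def])
  have "gradient F_DR = dr.env_grad"
    unfolding F by (rule ext, rule gradient_eq, rule dr.F_gradient)
  then show ?thesis
    using dr.F_convex dr.F_gradient dr.env_grad_lipschitz dr.F_strongly_convex
    unfolding F L_DR_def \<mu>_DR_def dr.\<alpha>_def dr.\<kappa>_def by auto
qed

end
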